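(* Assume that for all $j\in\{1,2,\dots,N-1\}$ we have $\beta^2\bigl(1-\cos\bigl(\frac{2\pi j}{N}\bigr)\bigr)\neq2\alpha^2$. Then for every $t\ge0$ the expectations $\mu_Z(t)=\mathbb{E}[Z(t)]$ and $\mu_X(t)=\mathbb{E}[X(t)]$ satisfy $$\mu_Z(t)=\begin{bmatrix}\frac LN\mathbf{1}\\ \bar p(0)\mathbf{1}\end{bmatrix}+\sum_{j=1}^{N-1}\begin{bmatrix}\frac{(v_j^*Q(0))(e^{t\lambda_{j,2}}\lambda_{j,1}-e^{t\lambda_{j,1}}\lambda_{j,2})-(v_j^*p(0))(e^{t\lambda_{j,2}}-e^{t\lambda_{j,1}})\kappa_j}{\lambda_{j,1}-\lambda_{j,2}}v_j\\[2mm] \frac{(v_j^*Q(0))(e^{t\lambda_{j,2}}-e^{t\lambda_{j,1}})\lambda_{j,1}\lambda_{j,2}-(v_j^*p(0))(e^{t\lambda_{j,2}}\lambda_{j,2}-e^{t\lambda_{j,1}}\lambda_{j,1})\kappa_j}{\kappa_j(\lambda_{j,1}-\lambda_{j,2})}v_j\end{bmatrix}$$ and $$\mu_X(t)=\begin{bmatrix}\frac LN\mathbf{1}\\0\end{bmatrix}+\sum_{j=1}^{N-1}\begin{bmatrix}\frac{(v_j^*Q(0))(e^{t\lambda_{j,2}}\lambda_{j,1}-e^{t\lambda_{j,1}}\lambda_{j,2})-(v_j^*p(0))(e^{t\lambda_{j,2}}-e^{t\lambda_{j,1}})\kappa_j}{\lambda_{j,1}-\lambda_{j,2}}v_j\\[2mm]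 \frac{(v_j^*Q(0))(e^{t\lambda_{j,2}}-e^{t\lambda_{j,1}})\lambda_{j,1}\lambda_{j,2}-(v_j^*p(0))(e^{t\lambda_{j,2}}\lambda_{j,2}-e^{t\lambda_{j,1}}\lambda_{j,1})\kappa_j}{\kappa_j(\lambda_{j,1}-\lambda_{j,2})}v_j\end{bmatrix},$$ where $\bar p(0)=\frac1N\sum_{n=1}^Np_n(0)$.
   Context: $N\ge3$ is an integer, $L>0$, $\alpha,\beta\in(0,\infty)$, $\sigma\in\mathbb{R}$, and $W$ is an $N$-dimensional standard Brownian motion. $\mathbf{1}=(1,\dots,1)^\top\in\mathbb{R}^N$ and $I$ is the $N\times N$ identity matrix. $A\in\mathbb{R}^{N\times N}$ is the circulant matrix with $A_{n,n}=-1$ for all $n$, $A_{n,n+1}=1$ for $n\in\{1,\dots,N-1\}$, $A_{N,1}=1$, and all other entries $0$. $$B=\begin{bmatrix}0&A\\-\alpha^2A^\top&-\beta A^\top A\end{bmatrix}\in\mathbb{R}^{2N\times2N},\qquad G=\begin{bmatrix}0\\ \sigma I\end{bmatrix}\in\mathbb{R}^{2N\times N}.$$ $Z(t)=(Q(t),p(t))^\top\in\mathbb{R}^{2N}$ is the solution of the linear SDE $dZ(t)=BZ(t)\,dt+G\,dW(t)$ with deterministic initial value $Z(0)=(Q(0),p(0))^\top$, where $Q(0)\in[0,\infty)^N$ satisfies $\sum_{n=1}^NQ_n(0)=L$ and $p(0)\in\mathbb{R}^N$. $M=I-\frac1N\mathbf{1}\mathbf{1}^\top$ and $X(t)=(Q(t),Mp(t))^\top\in\mathbb{R}^{2N}$.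 Further notation: $\omega=e^{2\pi\mathrm{i}/N}$ and, for $j\in\{0,\dots,N-1\}$, $\kappa_j=\omega^j-1$, $v_j=\frac1{\sqrt N}(1,\omega^j,\omega^{2j},\dots,\omega^{(N-1)j})^\top\in\mathbb{C}^N$, $\mu_j=2-2\cos(2\pi j/N)$, and for $k\in\{1,2\}$, $\lambda_{j,k}=\frac12\bigl(-\beta\mu_j+(-1)^k\sqrt{\beta^2\mu_j^2-4\alpha^2\mu_j}\bigr)\in\mathbb{C}$, where the square root of a real number is the principal (complex) one. $^*$ denotes conjugate transpose. *)

theory Defs
  imports "HOL-Probability.Probability" "Jordan_Normal_Form.Matrix"
begin

text \<open>
  Vectors and matrices have explicit dimensions and are indexed from 0, so row and column
  \<open>n\<close> of the mathematical notation have index \<open>n - 1\<close> here. Random vectors are functions into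
  \<^typ>\<open>real vec\<close>; as this type carries no topology, all measure-theoretic notions are
  componentwise.
\<close>

section \<open>Brownian motion\<close>

definition brownian_motion :: "'w measure \<Rightarrow> (real \<Rightarrow> 'w \<Rightarrow> real) \<Rightarrow> bool" where
  "brownian_motion M b \<longleftrightarrow>
     (\<forall>t\<ge>0. b t \<in> borel_measurable M) \<and>
     (AE w in M. b 0 w = 0) \<and>
     (AE w in M. continuous_on {0..} (\<lambda>t. b t w)) \<and>
     (\<forall>s t. 0 \<le> s \<and> s < t \<longrightarrow>
        distributed M lborel (\<lambda>w. b t w - b s w) (normal_density 0 (sqrt (t - s)))) \<and>
     (\<forall>(n::nat) (\<tau> :: nat \<Rightarrow> real). 0 \<le> \<tau> 0 \<and> (\<forall>k<n. \<tau> k < \<tau> (Suc k)) \<longrightarrow>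
        prob_space.indep_vars M (\<lambda>_. borel) (\<lambda>k w. b (\<tau> (Suc k)) w - b (\<tau> k) w) {..<n})"

text \<open>Independence of the components is independence of whole paths.\<close>

definition standard_brownian_motion_vec ::
    "'w measure \<Rightarrow> nat \<Rightarrow> (real \<Rightarrow> 'w \<Rightarrow> real vec) \<Rightarrow> bool" where
  "standard_brownian_motion_vec M n W \<longleftrightarrow>
     (\<forall>t\<ge>0. \<forall>w\<in>space M. W t w \<in> carrier_vec n) \<and>
     (\<forall>i<n. brownian_motion M (\<lambda>t w. W t w $ i)) \<and>
     prob_space.indep_vars M (\<lambda>_. PiM {0..} (\<lambda>_. borel))
       (\<lambda>i w. \<lambda>t\<in>{0..}. W t w $ i) {..<n}"

section \<open>Linear stochastic differential equations with additive noise\<close>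

text \<open>
  \<open>Z\<close> solves \<open>dZ(t) = B Z(t) dt + G dW(t)\<close>, \<open>Z(0) = z0\<close>, on \<open>[0,\<infinity>)\<close>. As \<open>G\<close> is constant, the
  Ito integral of \<open>G\<close> over \<open>[0,t]\<close> is \<open>G (W(t) - W(0))\<close>, so the integral equation makes sense
  path by path. No adaptedness is demanded of \<open>Z\<close>; a solution that is adapted to a filtration
  is in particular a solution in the present sense.
\<close>

definition linear_SDE_solution ::
    "'w measure \<Rightarrow> real mat \<Rightarrow> real mat \<Rightarrow> (real \<Rightarrow> 'w \<Rightarrow> real vec) \<Rightarrow> real vec \<Rightarrow>
     (real \<Rightarrow> 'w \<Rightarrow> real vec) \<Rightarrow> bool" where
  "linear_SDE_solution M B G W z0 Z \<longleftrightarrow>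
     (\<forall>t\<ge>0. \<forall>w\<in>space M. Z t w \<in> carrier_vec (dim_vec z0)) \<and>
     (\<forall>t\<ge>0. \<forall>i<dim_vec z0. (\<lambda>w. Z t w $ i) \<in> borel_measurable M) \<and>
     (AE w in M. \<forall>i<dim_vec z0. continuous_on {0..} (\<lambda>t. Z t w $ i)) \<and>
     (AE w in M. Z 0 w = z0) \<and>
     (AE w in M. \<forall>t\<ge>0.
        Z t w = Z 0 w
              + vec (dim_vec z0) (\<lambda>i. integral {0..t} (\<lambda>s. (B *\<^sub>v Z s w) $ i))
              + G *\<^sub>v (W t w - W 0 w))"

section \<open>Expectation of random vectors\<close>

definition integrable_vec :: "'w measure \<Rightarrow> nat \<Rightarrow> ('w \<Rightarrow> real vec) \<Rightarrow> bool" where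
  "integrable_vec M n Y \<longleftrightarrow> (\<forall>i<n. integrable M (\<lambda>w. Y w $ i))"

definition expectation_vec :: "'w measure \<Rightarrow> nat \<Rightarrow> ('w \<Rightarrow> real vec) \<Rightarrow> real vec" where
  "expectation_vec M n Y = vec n (\<lambda>i. LINT w|M. Y w $ i)"

section \<open>The model\<close>

definition ones :: "nat \<Rightarrow> real vec" where
  "ones N = vec N (\<lambda>_. 1)"

definition mat_A :: "nat \<Rightarrow> real mat" where
  "mat_A N = mat N N (\<lambda>(i, j).
     if j = i then -1 else if j = i + 1 \<or> (i = N - 1 \<and> j = 0) then 1 else 0)"

definition mat_B :: "real \<Rightarrow> real \<Rightarrow> nat \<Rightarrow> real mat" where
  "mat_B \<alpha> \<beta> N = four_block_mat
     (0\<^sub>m N N) (mat_A N)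
     (- (\<alpha>\<^sup>2) \<cdot>\<^sub>m transpose_mat (mat_A N)) (- \<beta> \<cdot>\<^sub>m (transpose_mat (mat_A N) * mat_A N))"

definition mat_G :: "real \<Rightarrow> nat \<Rightarrow> real mat" where
  "mat_G \<sigma> N = 0\<^sub>m N N @\<^sub>r (\<sigma> \<cdot>\<^sub>m 1\<^sub>m N)"

definition mat_M :: "nat \<Rightarrow> real mat" where
  "mat_M N = 1\<^sub>m N - (1 / real N) \<cdot>\<^sub>m (mat_of_cols N [ones N] * mat_of_rows N [ones N])"

text \<open>\<open>X = (Q, M p)\<close> as a function of \<open>Z = (Q, p)\<close>.\<close>

definition proc_X :: "nat \<Rightarrow> (real \<Rightarrow> 'w \<Rightarrow> real vec) \<Rightarrow> real \<Rightarrow> 'w \<Rightarrow> real vec" where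
  "proc_X N Z t w = vec_first (Z t w) N @\<^sub>v (mat_M N *\<^sub>v vec_last (Z t w) N)"

section \<open>Spectral data\<close>

definition omega :: "nat \<Rightarrow> complex" where
  "omega N = exp (2 * of_real pi * \<i> / of_nat N)"

definition kappa :: "nat \<Rightarrow> nat \<Rightarrow> complex" where
  "kappa N j = omega N ^ j - 1"

definition eigvec :: "nat \<Rightarrow> nat \<Rightarrow> complex vec" where
  "eigvec N j = (1 / of_real (sqrt (real N))) \<cdot>\<^sub>v vec N (\<lambda>m. omega N ^ (m * j))"

definition mu :: "nat \<Rightarrow> nat \<Rightarrow> real" where
  "mu N j = 2 - 2 * cos (2 * pi * real j / real N)"

definition lambda :: "real \<Rightarrow> real \<Rightarrow> nat \<Rightarrow> nat \<Rightarrow> nat \<Rightarrow> complex" where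
  "lambda \<alpha> \<beta> N j k = 1 / 2 *
     (- of_real (\<beta> * mu N j)
      + (-1) ^ k * csqrt (of_real (\<beta>\<^sup>2 * (mu N j)\<^sup>2 - 4 * \<alpha>\<^sup>2 * mu N j)))"

abbreviation cvec :: "real vec \<Rightarrow> complex vec" where
  "cvec \<equiv> map_vec complex_of_real"

end

theory Submission
  imports Defs
begin

text \<open>
  If \<open>\<ell>\<close> is a left eigenvector of \<open>B\<close> for \<open>c\<close>, then \<open>y = \<ell> Z\<close> solves, path by path, the scalar
  equation \<open>y(t) = y(0) + c \<integral>\<^sub>0\<^sup>t y + n(t)\<close> with \<open>n\<close> a linear combination of Brownian motions, hence
  \<open>y(t) = e\<^sup>c\<^sup>t y(0) + n(t) + c \<integral>\<^sub>0\<^sup>t e\<^sup>c\<^sup>(\<^sup>t\<^sup>-\<^sup>s\<^sup>) n(s) ds\<close>, and by Fubini the two noise terms have mean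
  zero. The left eigenvectors of \<open>B\<close> are \<open>(-\<lambda>\<^sub>j\<^sub>2 v\<^sub>j\<^sup>*, \<kappa>\<^sub>j v\<^sub>j\<^sup>*)\<close> for \<open>\<lambda>\<^sub>j\<^sub>1\<close> and, symmetrically,
  \<open>(-\<lambda>\<^sub>j\<^sub>1 v\<^sub>j\<^sup>*, \<kappa>\<^sub>j v\<^sub>j\<^sup>*)\<close> for \<open>\<lambda>\<^sub>j\<^sub>2\<close>, together with \<open>(v\<^sub>0\<^sup>*, 0)\<close> and \<open>(0, v\<^sub>0\<^sup>*)\<close> for the
  eigenvalue 0. As \<open>\<lambda>\<^sub>j\<^sub>1 \<noteq> \<lambda>\<^sub>j\<^sub>2\<close>, they determine the means of all Fourier coefficients
  \<open>v\<^sub>j\<^sup>* Q\<close> and \<open>v\<^sub>j\<^sup>* p\<close>, and Fourier inversion gives the means of \<open>Q\<close> and \<open>p\<close>.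
\<close>

section \<open>Means up to null sets\<close>

text \<open>
  Path integrals agree only almost surely with a measurable function, since the paths are
  continuous only almost surely; hence the representative \<open>R\<close>.
\<close>

definition has_mean :: "'w measure \<Rightarrow> ('w \<Rightarrow> complex) \<Rightarrow> complex \<Rightarrow> bool" where
  "has_mean M f c \<longleftrightarrow> (\<exists>R. has_bochner_integral M R c \<and> (AE w in M. f w = R w))"

lemma has_meanI: "has_bochner_integral M f c \<Longrightarrow> has_mean M f c"
  unfolding has_mean_def by auto

lemma has_mean_const:
  assumes "prob_space M" shows "has_mean M (\<lambda>_. c) c"
proof -
  interpret prob_space M by fact
  show ?thesis
    by (rule has_meanI) (simp add: has_bochner_integral_iff prob_space)
qed

lemma has_mean_cong_AE:
  assumes "has_mean M f c" "AE w in M. g w = f w"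
  shows "has_mean M g c"
proof -
  obtain R where R: "has_bochner_integral M R c" "AE w in M. f w = R w"
    using assms(1) unfolding has_mean_def by blast
  have "AE w in M. g w = R w" using assms(2) R(2) by eventually_elim simp
  with R(1) show ?thesis unfolding has_mean_def by blast
qed

lemma has_mean_add:
  assumes "has_mean M f c" "has_mean M g d"
  shows "has_mean M (\<lambda>w. f w + g w) (c + d)"
proof -
  obtain R where R: "has_bochner_integral M R c" "AE w in M. f w = R w"
    using assms(1) unfolding has_mean_def by blast
  obtain S where S: "has_bochner_integral M S d" "AE w in M. g w = S w"
    using assms(2) unfolding has_mean_def by blast
  have "AE w in M. f w + g w = R w + S w" using S(2) R(2) by eventually_elim simp
  with has_bochner_integral_add[OF R(1) S(1)] show ?thesis unfolding has_mean_def by blast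
qed

lemma has_mean_mult_right:
  assumes "has_mean M f c"
  shows "has_mean M (\<lambda>w. a * f w) (a * c)"
proof -
  obtain R where R: "has_bochner_integral M R c" "AE w in M. f w = R w"
    using assms(1) unfolding has_mean_def by blast
  have "AE w in M. a * f w = a * R w" using R(2) by eventually_elim simp
  with has_bochner_integral_mult_right[OF R(1)] show ?thesis unfolding has_mean_def by blast
qed

lemma has_mean_sum:
  assumes "prob_space M" "\<And>i. i \<in> I \<Longrightarrow> has_mean M (f i) (c i)"
  shows "has_mean M (\<lambda>w. \<Sum>i\<in>I. f i w) (\<Sum>i\<in>I. c i)"
  using assms(2)
  by (induction I rule: infinite_finite_induct)
     (auto intro: has_mean_add has_mean_const[OF assms(1), of 0, simplified])

text \<open>Measurability of \<open>f\<close> carries integrability over from the almost surely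
  equal representative to \<open>f\<close> itself; this is the passage from \<open>has_mean\<close>
  back to genuine expectations.\<close>

lemma has_mean_of_real:
  assumes "has_mean M (\<lambda>w. of_real (f w)) c" "f \<in> borel_measurable M"
  shows "integrable M f" "of_real (LINT w|M. f w) = c"
proof -
  obtain R where R: "has_bochner_integral M R c" "AE w in M. of_real (f w) = R w"
    using assms(1) unfolding has_mean_def by blast
  have m: "(\<lambda>w. complex_of_real (f w)) \<in> borel_measurable M"
    using assms(2) by measurable
  have "has_bochner_integral M (\<lambda>w. complex_of_real (f w)) c"
    using R m by (subst has_bochner_integral_cong_AE[OF m _ R(2)]) (auto simp: has_bochner_integral_iff)
  then show "integrable M f" "of_real (LINT w|M. f w) = c"
    by (auto simp: has_bochner_integral_iff complex_of_real_integrable_eq)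
qed

section \<open>Linear equations driven by Brownian motion\<close>

text \<open>The difference \<open>u = y - n\<close> is differentiable even when \<open>y\<close> and
  \<open>n\<close> are rough, with derivative \<open>c * y = c * u + c * n\<close>. Integrating the
  derivative of \<open>exp ((t - s) * c) * u s\<close> over \<open>{0..t}\<close> yields the formula
  without any stochastic integral.\<close>

lemma scalar_variation_of_constants:
  fixes y n :: "real \<Rightarrow> complex"
  assumes y: "continuous_on {0..} y"
    and eq: "\<And>s. s \<ge> 0 \<Longrightarrow> y s = y0 + c * integral {0..s} y + n s"
    and t: "t \<ge> 0"
  shows "y t = exp (of_real t * c) * y0 + n t
               + c * integral {0..t} (\<lambda>s. exp (of_real (t - s) * c) * n s)"
proof -
  define u where "u s = y0 + c * integral {0..s} y" for s
  have yc: "continuous_on {0..t} y" using y by (rule continuous_on_subset) auto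
  have du: "(u has_vector_derivative c * y s) (at s within {0..t})" if "s \<in> {0..t}" for s
    unfolding u_def
    by (auto intro!: derivative_eq_intros integral_has_vector_derivative[OF yc that])
  have de: "((\<lambda>s. exp (of_real (t - s) * c)) has_vector_derivative - c * exp (of_real (t - s) * c))
      (at s within {0..t})" for s
  proof -
    have "((\<lambda>z. exp ((of_real t - z) * c)) has_field_derivative - c * exp ((of_real t - of_real s) * c))
      (at (of_real s))"
      by (auto intro!: derivative_eq_intros)
    from has_vector_derivative_real_field[OF this] show ?thesis by simp
  qed
  have "((\<lambda>s. exp (of_real (t - s) * c) * (c * y s) + - c * exp (of_real (t - s) * c) * u s)
      has_integral exp (of_real (t - t) * c) * u t - exp (of_real (t - 0) * c) * u 0) {0..t}"
    using t by (intro fundamental_theorem_of_calculus has_vector_derivative_mult du de) auto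
  \<comment> \<open>Inserting \<open>y = u + n\<close> cancels the terms in \<open>u\<close>, so
    only the noise stays under the integral.\<close>
  moreover have "exp (of_real (t - s) * c) * (c * y s) + - c * exp (of_real (t - s) * c) * u s
      = c * (exp (of_real (t - s) * c) * n s)" if "s \<in> {0..t}" for s
    using eq[of s] that by (simp add: u_def algebra_simps)
  ultimately have "((\<lambda>s. c * (exp (of_real (t - s) * c) * n s))
      has_integral u t - exp (of_real t * c) * y0) {0..t}"
    by (subst has_integral_cong[where g = "\<lambda>s. exp (of_real (t - s) * c) * (c * y s) + - c * exp (of_real (t - s) * c) * u s"])
       (auto simp: u_def)
  then have "c * integral {0..t} (\<lambda>s. exp (of_real (t - s) * c) * n s) = u t - exp (of_real t * c) * y0"
    by (metis integral_mult_right integral_unique)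
  with eq[OF t] show ?thesis by (simp add: u_def)
qed

text \<open>The estimate \<open>\<bar>x\<bar> \<le> 1 + x\<^sup>2\<close> turns the variance
  \<open>s\<close> into a bound on the first absolute moment that is uniform on bounded time
  intervals; the later use of Fubini rests on it.\<close>

lemma brownian_increment:
  assumes "prob_space M" "brownian_motion M b" "s \<ge> 0"
  shows "integrable M (\<lambda>w. b s w - b 0 w)" "(LINT w|M. b s w - b 0 w) = 0"
    "(LINT w|M. \<bar>b s w - b 0 w\<bar>) \<le> 1 + s"
proof -
  interpret prob_space M by fact
  have "integrable M (\<lambda>w. b s w - b 0 w) \<and> (LINT w|M. b s w - b 0 w) = 0
    \<and> (LINT w|M. \<bar>b s w - b 0 w\<bar>) \<le> 1 + s"
  \<comment> \<open>At \<open>s = 0\<close> the increment vanishes identically; the normal law is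
    given only for positive time differences.\<close>
  proof (cases "s = 0")
    case False
    with assms have s: "s > 0" by simp
    let ?X = "\<lambda>w. b s w - b 0 w"
    have D: "distributed M lborel ?X (normal_density 0 (sqrt s))"
    proof -
      have "\<forall>r t. 0 \<le> r \<and> r < t \<longrightarrow>
          distributed M lborel (\<lambda>w. b t w - b r w) (normal_density 0 (sqrt (t - r)))"
        using assms(2) unfolding brownian_motion_def by blast
      from this[rule_format, of 0 s] s show ?thesis by simp
    qed
    have i1: "integrable M ?X"
      using distributed_integrable[OF D, of "\<lambda>x. x"] integrable_normal_moment[of "sqrt s" 0 1] s by simp
    have i2: "integrable M (\<lambda>w. (?X w)\<^sup>2)"
      using distributed_integrable[OF D, of "\<lambda>x. x\<^sup>2"] integrable_normal_moment[of "sqrt s" 0 2] s by simp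
    have e1: "(LINT w|M. ?X w) = 0"
      using normal_distributed_expectation[OF _ D] s by simp
    have e2: "(LINT w|M. (?X w)\<^sup>2) = s"
      using normal_distributed_variance[OF _ D] s e1 by simp
    have "\<bar>x\<bar> \<le> 1 + x\<^sup>2" for x :: real
      using zero_le_power2[of "\<bar>x\<bar> - 1"] abs_ge_zero[of x] unfolding power2_diff power2_abs by simp
    then have "(LINT w|M. \<bar>?X w\<bar>) \<le> (LINT w|M. 1 + (?X w)\<^sup>2)"
      by (intro integral_mono) (use i1 i2 in auto)
    also have "\<dots> = 1 + s" using i2 e2 by (simp add: prob_space)
    finally show ?thesis using i1 e1 by simp
  qed simp
  then show "integrable M (\<lambda>w. b s w - b 0 w)" "(LINT w|M. b s w - b 0 w) = 0"
    "(LINT w|M. \<bar>b s w - b 0 w\<bar>) \<le> 1 + s" by auto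
qed

text \<open>Sampling a path at the grid point of mesh \<open>1 / Suc n\<close> just below the given
  time is jointly measurable, since the grid is countable. Continuity of the paths makes these
  samples converge pointwise to \<open>x\<close>.\<close>

lemma borel_measurable_caratheodory:
  fixes x :: "real \<Rightarrow> 'a \<Rightarrow> real"
  assumes meas: "\<And>s. x s \<in> borel_measurable M"
    and cont: "\<And>w. w \<in> space M \<Longrightarrow> continuous_on UNIV (\<lambda>s. x s w)"
  shows "(\<lambda>p. x (fst p) (snd p)) \<in> borel_measurable (lborel \<Otimes>\<^sub>M M)"
proof (rule borel_measurable_LIMSEQ_metric)
  fix n :: nat
  show "(\<lambda>p. x (of_int \<lfloor>real (Suc n) * fst p\<rfloor> / real (Suc n)) (snd p))
      \<in> borel_measurable (lborel \<Otimes>\<^sub>M M)"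
  proof (rule measurable_compose_countable[where f = "\<lambda>i p. x (of_int i / real (Suc n)) (snd p)"])
    show "(\<lambda>p. x (of_int i / real (Suc n)) (snd p)) \<in> borel_measurable (lborel \<Otimes>\<^sub>M M)" for i :: int
      using meas by (rule measurable_compose[OF measurable_snd])
    show "(\<lambda>p. \<lfloor>real (Suc n) * fst p\<rfloor>) \<in> lborel \<Otimes>\<^sub>M M \<rightarrow>\<^sub>M count_space UNIV"
      by measurable
  qed
next
  fix p :: "real \<times> 'a" assume "p \<in> space (lborel \<Otimes>\<^sub>M M)"
  then have w: "snd p \<in> space M" by (auto simp: space_pair_measure)
  have "(\<lambda>n. of_int \<lfloor>real (Suc n) * fst p\<rfloor> / real (Suc n)) \<longlonglongrightarrow> fst p"
  proof (rule real_tendsto_sandwich)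
    show "\<forall>\<^sub>F n in sequentially. fst p - 1 / real (Suc n) \<le> of_int \<lfloor>real (Suc n) * fst p\<rfloor> / real (Suc n)"
    proof (intro always_eventually allI)
      fix n
      have "real (Suc n) * fst p - 1 \<le> of_int \<lfloor>real (Suc n) * fst p\<rfloor>" by linarith
      then have "(real (Suc n) * fst p - 1) / real (Suc n) \<le> of_int \<lfloor>real (Suc n) * fst p\<rfloor> / real (Suc n)"
        by (rule divide_right_mono) simp
      then show "fst p - 1 / real (Suc n) \<le> of_int \<lfloor>real (Suc n) * fst p\<rfloor> / real (Suc n)"
        by (simp add: diff_divide_distrib del: of_nat_Suc)
    qed
    show "\<forall>\<^sub>F n in sequentially. of_int \<lfloor>real (Suc n) * fst p\<rfloor> / real (Suc n) \<le> fst p"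
    proof (intro always_eventually allI)
      fix n
      have "of_int \<lfloor>real (Suc n) * fst p\<rfloor> \<le> real (Suc n) * fst p" by linarith
      then show "of_int \<lfloor>real (Suc n) * fst p\<rfloor> / real (Suc n) \<le> fst p"
        by (simp add: field_simps del: of_nat_Suc)
    qed
    have "(\<lambda>n. fst p - 1 / real (Suc n)) \<longlonglongrightarrow> fst p - 0"
      by (intro tendsto_intros LIMSEQ_Suc[OF lim_1_over_n])
    then show "(\<lambda>n. fst p - 1 / real (Suc n)) \<longlonglongrightarrow> fst p" by simp
  qed simp
  moreover have "isCont (\<lambda>s. x s (snd p)) (fst p)"
    using cont[OF w] by (simp add: continuous_on_eq_continuous_at)
  ultimately show "(\<lambda>n. x (of_int \<lfloor>real (Suc n) * fst p\<rfloor> / real (Suc n)) (snd p)) \<longlonglongrightarrow> x (fst p) (snd p)"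
    by (rule isCont_tendsto_compose[rotated])
qed

text \<open>By Fubini the expectation moves inside the time integral, where every increment has mean
  zero.\<close>

lemma has_mean_brownian_integral:
  fixes f :: "real \<Rightarrow> complex"
  assumes M: "prob_space M" and b: "brownian_motion M b" and f: "continuous_on {0..t} f"
  shows "has_mean M (\<lambda>w. integral {0..t} (\<lambda>s. f s * of_real (b s w - b 0 w))) 0"
proof -
  interpret prob_space M by fact
  interpret P: pair_sigma_finite lborel M ..
  have meas_b: "\<And>s. s \<ge> 0 \<Longrightarrow> b s \<in> borel_measurable M"
    and "AE w in M. continuous_on {0..} (\<lambda>s. b s w)"
    using b unfolding brownian_motion_def by blast+
  then obtain E where E: "\<And>w. w \<in> space M - E \<Longrightarrow> continuous_on {0..} (\<lambda>s. b s w)"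
    "E \<in> null_sets M"
    by (elim AE_E3) blast
  \<comment> \<open>The modification makes all paths continuous, so that \<open>x\<close> is jointly measurable.\<close>
  define x where "x s w = indicator (- E) w * (b (max 0 s) w - b 0 w)" for s w
  have x_eq: "x s w = b s w - b 0 w" if "w \<notin> E" "s \<ge> 0" for s w
    using that by (simp add: x_def max_def)
  have [measurable]: "E \<in> sets M" using E(2) by auto
  have meas_x: "x s \<in> borel_measurable M" for s
  proof -
    have [measurable]: "b (max 0 s) \<in> borel_measurable M" "b 0 \<in> borel_measurable M"
      using meas_b by auto
    show ?thesis unfolding x_def by measurable
  qed
  have cont_x: "continuous_on UNIV (\<lambda>s. x s w)" if "w \<in> space M" for w
  proof (cases "w \<in> E")
    case False
    have "continuous_on UNIV (\<lambda>s. b (max 0 s) w)"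
      by (rule continuous_on_compose2[OF E(1)]) (use that False in \<open>auto intro!: continuous_intros\<close>)
    then show ?thesis unfolding x_def by (intro continuous_intros)
  qed (simp add: x_def)
  have notin: "AE w in M. w \<notin> E" using E(2) by (rule AE_not_in)
  have x_int: "integrable M (x s)" "(LINT w|M. x s w) = 0" "(LINT w|M. \<bar>x s w\<bar>) \<le> 1 + s"
    if s: "s \<ge> 0" for s
  proof -
    have ae: "AE w in M. x s w = b s w - b 0 w"
      using notin by eventually_elim (simp add: x_eq s)
    have [measurable]: "b s \<in> borel_measurable M" "b 0 \<in> borel_measurable M"
      using meas_b s by auto
    note [measurable] = meas_x
    show "integrable M (x s)"
      using brownian_increment(1)[OF M b s] ae by (subst integrable_cong_AE[OF _ _ ae]) measurable
    show "(LINT w|M. x s w) = 0"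
      using brownian_increment(2)[OF M b s] integral_cong_AE[OF _ _ ae] by simp
    have "AE w in M. \<bar>x s w\<bar> = \<bar>b s w - b 0 w\<bar>" using ae by eventually_elim simp
    then have "(LINT w|M. \<bar>x s w\<bar>) = (LINT w|M. \<bar>b s w - b 0 w\<bar>)"
      by (intro integral_cong_AE) measurable
    then show "(LINT w|M. \<bar>x s w\<bar>) \<le> 1 + s" using brownian_increment(3)[OF M b s] by simp
  qed
  \<comment> \<open>Cutting \<open>f\<close> off outside \<open>{0..t}\<close> gives an integrable
    function on the whole line, so that Fubini can be applied on
    \<open>lborel \<Otimes>\<^sub>M M\<close>.\<close>
  define F where "F s = indicator {0..t} s *\<^sub>R f s" for s
  have F_int: "integrable lborel F"
    using borel_integrable_atLeastAtMost'[OF f] unfolding set_integrable_def F_def .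
  then have [measurable]: "F \<in> borel_measurable lborel" by auto
  have F_0: "F s = 0" if "s \<notin> {0..t}" for s using that by (simp add: F_def)
  define h where "h = (\<lambda>p. F (fst p) * of_real (x (fst p) (snd p)))"
  have [measurable]: "h \<in> borel_measurable (lborel \<Otimes>\<^sub>M M)"
  proof -
    note [measurable] = borel_measurable_caratheodory[of x M, OF meas_x cont_x]
    show ?thesis unfolding h_def by measurable
  qed
  have h_int: "integrable (lborel \<Otimes>\<^sub>M M) h"
  proof (rule P.Fubini_integrable)
    have [measurable]: "(\<lambda>s. LINT w|M. norm (h (s, w))) \<in> borel_measurable lborel"
      by measurable
    have eq: "(LINT w|M. norm (h (s, w))) = norm (F s) * (LINT w|M. \<bar>x s w\<bar>)" for s
      by (simp add: h_def norm_mult)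
    show "integrable lborel (\<lambda>s. LINT w|M. norm (h (s, w)))"
    proof (rule Bochner_Integration.integrable_bound)
      \<comment> \<open>The moment bound \<open>1 + s\<close> is at most \<open>1 + t\<close>
        wherever \<open>F\<close> is nonzero, which provides this dominating function.\<close>
      show "integrable lborel (\<lambda>s. (1 + t) * norm (F s))" using F_int by simp
      have "norm (LINT w|M. norm (h (s, w))) \<le> norm ((1 + t) * norm (F s))" for s
      proof (cases "s \<in> {0..t}")
        case True
        then have "norm (F s) * (LINT w|M. \<bar>x s w\<bar>) \<le> norm (F s) * (1 + t)"
          using x_int(3)[of s] by (intro mult_left_mono) auto
        with True show ?thesis by (simp add: eq mult.commute abs_mult)
      qed (simp add: eq F_0)
      then show "AE s in lborel. norm (LINT w|M. norm (h (s, w))) \<le> norm ((1 + t) * norm (F s))"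
        by simp
    qed simp
    have "integrable M (\<lambda>w. h (s, w))" for s
      by (cases "s \<in> {0..t}") (use x_int(1)[of s] in \<open>auto simp: h_def F_0\<close>)
    then show "AE s in lborel. integrable M (\<lambda>w. h (s, w))" by simp
  qed simp
  have "(LINT w|M. LINT s|lborel. h (s, w)) = (LINT s|lborel. LINT w|M. h (s, w))"
    by (rule P.Fubini_integral) (use h_int in simp)
  also have "(LINT w|M. h (s, w)) = 0" for s
    by (cases "s \<in> {0..t}") (use x_int(2)[of s] in \<open>auto simp: h_def F_0\<close>)
  then have "(LINT s|lborel. LINT w|M. h (s, w)) = 0" by simp
  finally have "has_bochner_integral M (\<lambda>w. LINT s|lborel. h (s, w)) 0"
    using P.integrable_snd[of "\<lambda>s w. h (s, w)"] h_int by (simp add: has_bochner_integral_iff)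
  \<comment> \<open>Off the null set \<open>E\<close> the integrand is continuous in time, so the
    gauge integral along the path equals the Lebesgue integral of \<open>h\<close>.\<close>
  moreover have "AE w in M. integral {0..t} (\<lambda>s. f s * of_real (b s w - b 0 w)) = (LINT s|lborel. h (s, w))"
    using notin AE_space
  proof eventually_elim
    case (elim w)
    have "continuous_on {0..t} (\<lambda>s. f s * of_real (x s w))"
      using cont_x[OF elim(2)] by (intro continuous_intros f) (auto intro: continuous_on_subset)
    from set_borel_integral_eq_integral(2)[OF borel_integrable_atLeastAtMost'[OF this]]
    have "(LINT s|lborel. h (s, w)) = integral {0..t} (\<lambda>s. f s * of_real (x s w))"
      by (simp add: set_lebesgue_integral_def h_def F_def)
    also have "\<dots> = integral {0..t} (\<lambda>s. f s * of_real (b s w - b 0 w))"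
      by (intro integral_cong) (use elim(1) in \<open>auto simp: x_eq\<close>)
    finally show ?case by simp
  qed
  ultimately show ?thesis unfolding has_mean_def by blast
qed

text \<open>Applying the row \<open>l\<close> to the integral equation closes it into a scalar
  equation because \<open>l B = c l\<close>. Integrability is a result here: variation of constants
  expresses \<open>l Z\<close> by the initial value and the noise alone.\<close>

lemma linear_SDE_mean_left_eigenvector:
  fixes l :: "nat \<Rightarrow> complex" and z0 :: "real vec"
  assumes M: "prob_space M"
    and B: "B \<in> carrier_mat d d" and G: "G \<in> carrier_mat d n" and z0: "z0 \<in> carrier_vec d"
    and W: "standard_brownian_motion_vec M n W"
    and Z: "linear_SDE_solution M B G W z0 Z"
    and eig: "\<And>k. k < d \<Longrightarrow> (\<Sum>i<d. l i * of_real (B $$ (i, k))) = c * l k"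
    and t: "t \<ge> 0"
  shows "has_mean M (\<lambda>w. \<Sum>i<d. l i * of_real (Z t w $ i))
           (exp (of_real t * c) * (\<Sum>i<d. l i * of_real (z0 $ i)))"
proof -
  interpret prob_space M by fact
  define g where "g m = (\<Sum>i<d. l i * of_real (G $$ (i, m)))" for m
  define b where "b m s w = W s w $ m" for m s w
  define e where "e s = exp (of_real (t - s) * c)" for s
  define y0 where "y0 = (\<Sum>i<d. l i * of_real (z0 $ i))"
  have dz: "dim_vec z0 = d" using z0 by simp
  have W_carr: "W s w \<in> carrier_vec n" if "s \<ge> 0" "w \<in> space M" for s w
    using W that unfolding standard_brownian_motion_vec_def by blast
  have bm: "brownian_motion M (b m)" if "m < n" for m
    using W that unfolding standard_brownian_motion_vec_def b_def by blast
  have Z_carr: "Z s w \<in> carrier_vec d" if "s \<ge> 0" "w \<in> space M" for s w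
    using Z that unfolding linear_SDE_solution_def dz by blast
  have Z_cont: "AE w in M. \<forall>i<d. continuous_on {0..} (\<lambda>t. Z t w $ i)"
    and Z_0: "AE w in M. Z 0 w = z0"
    and Z_eq: "AE w in M. \<forall>t\<ge>0. Z t w = Z 0 w
              + vec d (\<lambda>i. integral {0..t} (\<lambda>s. (B *\<^sub>v Z s w) $ i)) + G *\<^sub>v (W t w - W 0 w)"
    using Z unfolding linear_SDE_solution_def dz by blast+
  have b_cont: "AE w in M. \<forall>m\<in>{..<n}. continuous_on {0..} (\<lambda>s. b m s w)"
    using bm unfolding brownian_motion_def by (intro AE_finite_allI) auto
  have e_cont: "continuous_on {0..t} e"
    unfolding e_def by (intro continuous_intros)
  \<comment> \<open>The mean of the explicit solution is computed first; the paths of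
    \<open>l Z\<close> are identified with it almost surely afterwards.\<close>
  have "has_mean M (\<lambda>w. exp (of_real t * c) * y0 + (\<Sum>m<n. g m * of_real (b m t w - b m 0 w))
      + c * (\<Sum>m<n. g m * integral {0..t} (\<lambda>s. e s * of_real (b m s w - b m 0 w))))
      (exp (of_real t * c) * y0 + (\<Sum>m<n. g m * of_real 0) + c * (\<Sum>m<n. g m * 0))"
  proof (intro has_mean_add has_mean_const has_mean_sum has_mean_mult_right M)
    fix m assume m: "m \<in> {..<n}"
    show "has_mean M (\<lambda>w. of_real (b m t w - b m 0 w)) (of_real 0)"
      using brownian_increment(1,2)[OF M bm t] m
      by (intro has_meanI has_bochner_integral_of_real) (auto simp: has_bochner_integral_iff)
    show "has_mean M (\<lambda>w. integral {0..t} (\<lambda>s. e s * of_real (b m s w - b m 0 w))) 0"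
      using m by (intro has_mean_brownian_integral[OF M bm e_cont]) auto
  qed
  moreover have "AE w in M. (\<Sum>i<d. l i * of_real (Z t w $ i)) =
      exp (of_real t * c) * y0 + (\<Sum>m<n. g m * of_real (b m t w - b m 0 w))
      + c * (\<Sum>m<n. g m * integral {0..t} (\<lambda>s. e s * of_real (b m s w - b m 0 w)))"
    using Z_cont Z_0 Z_eq b_cont AE_space
  proof eventually_elim
    case (elim w)
    define y where "y s = (\<Sum>i<d. l i * of_real (Z s w $ i))" for s
    define N where "N s = (\<Sum>m<n. g m * of_real (b m s w - b m 0 w))" for s
    have Zi: "Z s w $ i = z0 $ i + (\<Sum>k<d. B $$ (i, k) * integral {0..s} (\<lambda>r. Z r w $ k))
        + (\<Sum>m<n. G $$ (i, m) * (b m s w - b m 0 w))" if s: "s \<ge> 0" and i: "i < d" for s i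
    proof -
      have "Z s w = Z 0 w + vec d (\<lambda>i. integral {0..s} (\<lambda>r. (B *\<^sub>v Z r w) $ i)) + G *\<^sub>v (W s w - W 0 w)"
        using elim(3) s by blast
      then have "Z s w $ i = (Z 0 w + vec d (\<lambda>i. integral {0..s} (\<lambda>r. (B *\<^sub>v Z r w) $ i))
          + G *\<^sub>v (W s w - W 0 w)) $ i" by (rule arg_cong)
      also have "\<dots> = z0 $ i + integral {0..s} (\<lambda>r. (B *\<^sub>v Z r w) $ i) + (G *\<^sub>v (W s w - W 0 w)) $ i"
        using i z0 G elim(2) by simp
      also have "integral {0..s} (\<lambda>r. (B *\<^sub>v Z r w) $ i) = integral {0..s} (\<lambda>r. \<Sum>k<d. B $$ (i, k) * Z r w $ k)"
      proof (rule integral_cong)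
        fix r assume "r \<in> {0..s}"
        then have "Z r w \<in> carrier_vec d" using Z_carr elim(5) by simp
        then show "(B *\<^sub>v Z r w) $ i = (\<Sum>k<d. B $$ (i, k) * Z r w $ k)"
          using B i by (simp add: scalar_prod_def atLeast0LessThan)
      qed
      also have "\<dots> = (\<Sum>k<d. integral {0..s} (\<lambda>r. B $$ (i, k) * Z r w $ k))"
        using elim(1)
        by (intro integral_sum integrable_continuous_real continuous_intros)
           (auto intro: continuous_on_subset)
      also have "\<dots> = (\<Sum>k<d. B $$ (i, k) * integral {0..s} (\<lambda>r. Z r w $ k))" by simp
      also have "(G *\<^sub>v (W s w - W 0 w)) $ i = (\<Sum>m<n. G $$ (i, m) * (b m s w - b m 0 w))"
        using G i W_carr[OF s elim(5)] W_carr[OF order_refl elim(5)]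
        by (simp add: scalar_prod_def atLeast0LessThan b_def)
      finally show ?thesis .
    qed
    have int_y: "integral {0..s} y = (\<Sum>k<d. l k * of_real (integral {0..s} (\<lambda>r. Z r w $ k)))" for s
    proof (rule integral_unique)
      show "(y has_integral (\<Sum>k<d. l k * of_real (integral {0..s} (\<lambda>r. Z r w $ k)))) {0..s}"
        unfolding y_def using elim(1)
        by (intro has_integral_sum has_integral_mult_right has_integral_of_real
              integrable_integral integrable_continuous_real) (auto intro: continuous_on_subset)
    qed
    have "y s = y0 + c * integral {0..s} y + N s" if s: "s \<ge> 0" for s
    proof -
      have "y s = y0 + (\<Sum>i<d. \<Sum>k<d. l i * of_real (B $$ (i, k)) * of_real (integral {0..s} (\<lambda>r. Z r w $ k)))
          + (\<Sum>i<d. \<Sum>m<n. l i * of_real (G $$ (i, m)) * of_real (b m s w - b m 0 w))"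
        unfolding y_def y0_def using s
        by (simp add: Zi sum.distrib[symmetric] sum_distrib_left ring_distribs mult.assoc)
      \<comment> \<open>Summing over the row index first produces the entries of \<open>l B\<close>,
        to which \<open>eig\<close> applies.\<close>
      also have "(\<Sum>i<d. \<Sum>k<d. l i * of_real (B $$ (i, k)) * of_real (integral {0..s} (\<lambda>r. Z r w $ k)))
          = (\<Sum>k<d. (\<Sum>i<d. l i * of_real (B $$ (i, k))) * of_real (integral {0..s} (\<lambda>r. Z r w $ k)))"
        by (subst sum.swap) (simp add: sum_distrib_right)
      also have "\<dots> = c * integral {0..s} y"
        by (simp add: eig int_y sum_distrib_left mult.assoc)
      also have "(\<Sum>i<d. \<Sum>m<n. l i * of_real (G $$ (i, m)) * of_real (b m s w - b m 0 w)) = N s"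
        unfolding N_def g_def by (subst sum.swap) (simp add: sum_distrib_right)
      finally show ?thesis .
    qed
    moreover have "continuous_on {0..} y"
      unfolding y_def using elim(1) by (intro continuous_intros) auto
    ultimately have "y t = exp (of_real t * c) * y0 + N t + c * integral {0..t} (\<lambda>s. e s * N s)"
      unfolding e_def using t by (intro scalar_variation_of_constants) auto
    also have "integral {0..t} (\<lambda>s. e s * N s)
        = integral {0..t} (\<lambda>s. \<Sum>m<n. g m * (e s * of_real (b m s w - b m 0 w)))"
      by (simp add: N_def sum_distrib_left mult_ac)
    also have "\<dots> = (\<Sum>m<n. integral {0..t} (\<lambda>s. g m * (e s * of_real (b m s w - b m 0 w))))"
      using elim(4)
      by (intro integral_sum integrable_continuous_real continuous_intros e_cont)
         (auto intro: continuous_on_subset)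
    also have "\<dots> = (\<Sum>m<n. g m * integral {0..t} (\<lambda>s. e s * of_real (b m s w - b m 0 w)))"
      by simp
    finally show ?case by (simp add: y_def N_def)
  qed
  ultimately show ?thesis
    using has_mean_cong_AE by (force simp: y0_def)
qed

section \<open>Spectral decomposition\<close>

lemma omega_power: "omega N ^ k = exp (2 * of_real pi * \<i> * of_nat k / of_nat N)"
  unfolding omega_def by (simp flip: exp_of_nat_mult add: algebra_simps)

lemma omega_power_eq_iff: "m < N \<Longrightarrow> n < N \<Longrightarrow> omega N ^ m = omega N ^ n \<longleftrightarrow> m = n"
  using complex_root_unity_eq[of N m n] by (simp add: omega_power)

lemma omega_power_N: "N > 0 \<Longrightarrow> omega N ^ (N * k) = 1"
  using complex_root_unity[of N 1] omega_power[of N 1] by (simp add: power_mult)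

lemma omega_power_cis: "omega N ^ k = cis (2 * pi * real k / real N)"
  unfolding omega_power cis_conv_exp by (simp add: algebra_simps)

lemma omega_power_cnj: "omega N ^ k * cnj (omega N ^ k) = 1" "cnj (omega N ^ k) * omega N ^ k = 1"
  by (simp_all add: omega_power_cis cis_cnj cis_mult)

text \<open>For \<open>m \<noteq> n\<close> this is a geometric sum whose ratio \<open>z\<close> is
  an \<open>N\<close>-th root of unity other than 1.\<close>

lemma omega_orthogonal:
  assumes "m < N" "n < N"
  shows "(\<Sum>j<N. omega N ^ (m * j) * cnj (omega N ^ (n * j))) = (if m = n then of_nat N else 0)"
proof (cases "m = n")
  case False
  define z where "z = omega N ^ m * cnj (omega N ^ n)"
  have N: "N > 0" using assms by simp
  have z: "z \<noteq> 1"
  proof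
    assume "z = 1"
    then have "omega N ^ m * (cnj (omega N ^ n) * omega N ^ n) = omega N ^ n"
      unfolding z_def by (simp add: mult.assoc[symmetric])
    with assms False show False by (simp add: omega_power_cnj(2)[simplified] omega_power_eq_iff)
  qed
  have "z ^ N = omega N ^ (N * m) * cnj (omega N ^ (N * n))"
    by (simp add: z_def power_mult_distrib power_mult[symmetric] mult.commute)
  then have "z ^ N = 1" by (simp add: omega_power_N N del: complex_cnj_power)
  moreover have "(\<Sum>j<N. omega N ^ (m * j) * cnj (omega N ^ (n * j))) = (\<Sum>j<N. z ^ j)"
    by (simp add: z_def power_mult power_mult_distrib)
  ultimately show ?thesis using geometric_sum[OF z, of N] False by simp
qed (simp add: omega_power_cnj del: complex_cnj_power)

lemma eigvec_index: "m < N \<Longrightarrow> eigvec N j $ m = omega N ^ (m * j) / of_real (sqrt (real N))"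
  unfolding eigvec_def by simp

lemma dim_eigvec [simp]: "dim_vec (eigvec N j) = N"
  unfolding eigvec_def by simp

text \<open>Exchanging the sums leaves, for each pair of positions, a sum over the frequency
  \<open>j\<close>, and orthogonality reduces it to the term \<open>n = m\<close>.\<close>

lemma eigvec_expansion:
  assumes m: "m < N"
  shows "x m = (\<Sum>j<N. eigvec N j $ m * (\<Sum>n<N. cnj (eigvec N j $ n) * x n))"
proof -
  have s: "complex_of_real (sqrt (real N)) * of_real (sqrt (real N)) = of_nat N"
    by (simp flip: of_real_mult)
  have "(\<Sum>j<N. eigvec N j $ m * (\<Sum>n<N. cnj (eigvec N j $ n) * x n))
      = (\<Sum>j<N. \<Sum>n<N. omega N ^ (m * j) * cnj (omega N ^ (n * j)) * (x n / of_nat N))"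
    using m by (intro sum.cong refl) (simp add: eigvec_index sum_distrib_left s mult_ac flip: times_divide_eq_right)
  also have "\<dots> = (\<Sum>n<N. (\<Sum>j<N. omega N ^ (m * j) * cnj (omega N ^ (n * j))) * (x n / of_nat N))"
    by (subst sum.swap) (simp only: sum_distrib_right)
  also have "\<dots> = (\<Sum>n<N. if m = n then x n else 0)"
    using m by (intro sum.cong refl) (auto simp: omega_orthogonal simp del: complex_cnj_power)
  also have "\<dots> = x m" using m by simp
  finally show ?thesis by simp
qed

lemma eigvec_0_index: "m < N \<Longrightarrow> eigvec N 0 $ m = of_real (1 / sqrt (real N))"
  by (simp add: eigvec_index)

lemma kappa_0 [simp]: "kappa N 0 = 0"
  by (simp add: kappa_def)

lemma kappa_nonzero: "0 < j \<Longrightarrow> j < N \<Longrightarrow> kappa N j \<noteq> 0"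
  using omega_power_eq_iff[of j N 0] by (auto simp: kappa_def)

text \<open>This identifies \<open>mu N j\<close> as the squared modulus of
  \<open>kappa N j\<close>, hence as the eigenvalue of the product of \<open>mat_A\<close> with its
  transpose.\<close>

lemma kappa_cnj_kappa: "kappa N j * cnj (kappa N j) = of_real (mu N j)"
proof -
  define x where "x = 2 * pi * real j / real N"
  have "kappa N j = Complex (cos x - 1) (sin x)"
    unfolding kappa_def omega_power_cis x_def[symmetric] by (simp add: complex_eq_iff)
  moreover have "(cos x - 1)\<^sup>2 + (sin x)\<^sup>2 = 2 - 2 * cos x"
    using sin_cos_squared_add[of x] by (simp add: power2_diff)
  ultimately show ?thesis
    by (simp add: mu_def x_def[symmetric] complex_mult_cnj)
qed

section \<open>Left eigenvectors of the circulant matrix\<close>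

lemma mat_A_carrier [simp]: "mat_A N \<in> carrier_mat N N"
  by (simp add: mat_A_def)

text \<open>Column \<open>k\<close> has -1 at \<open>k\<close> and 1 at its cyclic predecessor
  \<open>p\<close>, and moving from \<open>k\<close> to \<open>p\<close> multiplies the conjugated
  entry by \<open>omega N ^ j\<close>. The bound on \<open>N\<close> keeps \<open>p\<close> and
  \<open>k\<close> apart.\<close>

lemma mat_A_left_eigenvector:
  assumes N: "N \<ge> 2" and k: "k < N"
  shows "(\<Sum>i<N. cnj (eigvec N j $ i) * of_real (mat_A N $$ (i, k))) = kappa N j * cnj (eigvec N j $ k)"
proof -
  define u where "u i = cnj (omega N ^ (i * j)) / of_real (sqrt (real N))" for i
  define p where "p = (if k = 0 then N - 1 else k - 1)"
  have p: "p < N" "p \<noteq> k" using N k by (auto simp: p_def)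
  have A: "mat_A N $$ (i, k) = (if i = k then -1 else 0) + (if i = p then 1 else 0)" if "i < N" for i
    using that k N by (auto simp: mat_A_def p_def)
  have up: "u p = omega N ^ j * u k"
  proof -
    have "omega N ^ (k * j) = omega N ^ (p * j) * omega N ^ j"
    \<comment> \<open>At the wrap-around \<open>k = 0\<close> the exponents differ by a multiple of
      \<open>N\<close>, which \<open>omega_power_N\<close> absorbs.\<close>
    proof (cases k)
      case 0
      then have "p * j + j = N * j" using N by (metis Suc_diff_1 add.commute k mult_Suc p_def)
      with 0 show ?thesis using omega_power_N[of N j] N by (simp flip: power_add)
    qed (simp add: p_def add.commute flip: power_add)
    then show ?thesis
      by (simp add: u_def omega_power_cnj[simplified] mult_ac flip: mult.assoc)
  qed
  have "(\<Sum>i<N. cnj (eigvec N j $ i) * of_real (mat_A N $$ (i, k)))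
      = (\<Sum>i<N. (if i = k then - u i else 0) + (if i = p then u i else 0))"
    by (intro sum.cong refl) (auto simp: A eigvec_index u_def)
  also have "\<dots> = - u k + u p" using k p by (simp add: sum.distrib)
  also have "\<dots> = kappa N j * u k" by (simp add: up kappa_def algebra_simps)
  finally show ?thesis using k by (simp add: u_def eigvec_index)
qed

text \<open>The mirror image of the previous argument: row \<open>k\<close> involves the cyclic
  successor, and the shift factor becomes \<open>cnj (omega N ^ j)\<close>.\<close>

lemma mat_A_transpose_left_eigenvector:
  assumes N: "N \<ge> 2" and k: "k < N"
  shows "(\<Sum>i<N. cnj (eigvec N j $ i) * of_real (mat_A N $$ (k, i)))
         = cnj (kappa N j) * cnj (eigvec N j $ k)"
proof -
  define u where "u i = cnj (omega N ^ (i * j)) / of_real (sqrt (real N))" for i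
  define p where "p = (if k = N - 1 then 0 else k + 1)"
  have p: "p < N" "p \<noteq> k" using N k by (auto simp: p_def)
  have A: "mat_A N $$ (k, i) = (if i = k then -1 else 0) + (if i = p then 1 else 0)" if "i < N" for i
    using that k N by (auto simp: mat_A_def p_def)
  have up: "u p = cnj (omega N ^ j) * u k"
  proof -
    have "omega N ^ (p * j) = omega N ^ (k * j) * omega N ^ j"
    proof (cases "k = N - 1")
      case True
      then have "k * j + j = N * j" using N by (metis Suc_diff_1 add.commute k mult_Suc neq0_conv not_less0)
      with True show ?thesis using omega_power_N[of N j] N by (simp add: p_def flip: power_add)
    qed (simp add: p_def power_add mult.commute)
    then show ?thesis by (simp add: u_def mult_ac)
  qed
  have "(\<Sum>i<N. cnj (eigvec N j $ i) * of_real (mat_A N $$ (k, i)))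
      = (\<Sum>i<N. (if i = k then - u i else 0) + (if i = p then u i else 0))"
    by (intro sum.cong refl) (auto simp: A eigvec_index u_def)
  also have "\<dots> = - u k + u p" using k p by (simp add: sum.distrib)
  also have "\<dots> = cnj (kappa N j) * u k" by (simp add: up kappa_def algebra_simps)
  finally show ?thesis using k by (simp add: u_def eigvec_index)
qed

text \<open>The same row is a left eigenvector of both factors, so the eigenvalues
  \<open>cnj (kappa N j)\<close> and \<open>kappa N j\<close> multiply.\<close>

lemma mat_AT_A_left_eigenvector:
  assumes N: "N \<ge> 2" and k: "k < N"
  shows "(\<Sum>i<N. cnj (eigvec N j $ i) * of_real ((transpose_mat (mat_A N) * mat_A N) $$ (i, k)))
         = of_real (mu N j) * cnj (eigvec N j $ k)"
proof -
  have d: "dim_row (mat_A N) = N" "dim_col (mat_A N) = N" by (simp_all add: mat_A_def)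
  have "(\<Sum>i<N. cnj (eigvec N j $ i) * of_real ((transpose_mat (mat_A N) * mat_A N) $$ (i, k)))
      = (\<Sum>i<N. \<Sum>m<N. cnj (eigvec N j $ i) * of_real (mat_A N $$ (m, i)) * of_real (mat_A N $$ (m, k)))"
    using k by (intro sum.cong refl)
      (simp add: scalar_prod_def d atLeast0LessThan sum_distrib_left mult.assoc)
  also have "\<dots> = (\<Sum>m<N. (\<Sum>i<N. cnj (eigvec N j $ i) * of_real (mat_A N $$ (m, i))) * of_real (mat_A N $$ (m, k)))"
    by (subst sum.swap) (simp only: sum_distrib_right)
  also have "\<dots> = cnj (kappa N j) * (\<Sum>m<N. cnj (eigvec N j $ m) * of_real (mat_A N $$ (m, k)))"
    using N by (simp add: mat_A_transpose_left_eigenvector sum_distrib_left mult.assoc)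
  also have "\<dots> = of_real (mu N j) * cnj (eigvec N j $ k)"
    unfolding mat_A_left_eigenvector[OF N k] kappa_cnj_kappa[symmetric] by simp
  finally show ?thesis .
qed

section \<open>Left eigenvectors and eigenvalues of the block matrix\<close>

lemma sum_lessThan_double:
  fixes f :: "nat \<Rightarrow> 'a :: comm_monoid_add"
  shows "(\<Sum>i<2 * N. f i) = (\<Sum>i<N. f i) + (\<Sum>i<N. f (N + i))"
proof -
  have "(\<Sum>i<N + m. f i) = (\<Sum>i<N. f i) + (\<Sum>i<m. f (N + i))" for m
    by (induction m) (simp_all add: add.assoc)
  from this[of N] show ?thesis by (simp add: mult_2)
qed

lemma mat_B_carrier: "mat_B \<alpha> \<beta> N \<in> carrier_mat (2 * N) (2 * N)"
  by (rule carrier_matI) (simp_all add: mat_B_def mat_A_def)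

lemma mat_B_left_eigenvector:
  assumes N: "N \<ge> 2" and k: "k < 2 * N"
    and a: "- (of_real (\<alpha>\<^sup>2) * cnj (kappa N j) * b) = c * a"
    and b: "a * kappa N j - of_real (\<beta> * mu N j) * b = c * b"
  defines "l \<equiv> \<lambda>i. if i < N then a * cnj (eigvec N j $ i) else b * cnj (eigvec N j $ (i - N))"
  shows "(\<Sum>i<2 * N. l i * of_real (mat_B \<alpha> \<beta> N $$ (i, k))) = c * l k"
proof -
  have d: "dim_row (mat_A N) = N" "dim_col (mat_A N) = N" by (simp_all add: mat_A_def)
  show ?thesis
  proof (cases "k < N")
    case True
    then have "(\<Sum>i<2 * N. l i * of_real (mat_B \<alpha> \<beta> N $$ (i, k)))
      = (\<Sum>i<N. b * cnj (eigvec N j $ i) * (- of_real (\<alpha>\<^sup>2) * of_real (mat_A N $$ (k, i))))"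
      by (simp add: sum_lessThan_double l_def mat_B_def d)
    also have "\<dots> = - of_real (\<alpha>\<^sup>2) * b * (\<Sum>i<N. cnj (eigvec N j $ i) * of_real (mat_A N $$ (k, i)))"
      by (simp add: sum_distrib_left mult_ac)
    also have "\<dots> = - (of_real (\<alpha>\<^sup>2) * cnj (kappa N j) * b) * cnj (eigvec N j $ k)"
      unfolding mat_A_transpose_left_eigenvector[OF N True] by simp
    finally show ?thesis using True by (simp only: a) (simp add: l_def)
  next
    case False
    define k' where "k' = k - N"
    have k': "k = N + k'" "k' < N" using False k by (auto simp: k'_def)
    then have "(\<Sum>i<2 * N. l i * of_real (mat_B \<alpha> \<beta> N $$ (i, k)))
      = (\<Sum>i<N. a * cnj (eigvec N j $ i) * of_real (mat_A N $$ (i, k')))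
        + (\<Sum>i<N. b * cnj (eigvec N j $ i) * (- of_real \<beta> *
              of_real ((transpose_mat (mat_A N) * mat_A N) $$ (i, k'))))"
      by (simp add: sum_lessThan_double l_def mat_B_def d)
    also have "\<dots> = a * (\<Sum>i<N. cnj (eigvec N j $ i) * of_real (mat_A N $$ (i, k')))
        - of_real \<beta> * b * (\<Sum>i<N. cnj (eigvec N j $ i) *
              of_real ((transpose_mat (mat_A N) * mat_A N) $$ (i, k')))"
      by (simp add: sum_distrib_left mult_ac sum_negf)
    also have "\<dots> = (a * kappa N j - of_real (\<beta> * mu N j) * b) * cnj (eigvec N j $ k')"
      unfolding mat_A_left_eigenvector[OF N k'(2)] mat_AT_A_left_eigenvector[OF N k'(2)]
      by (simp add: algebra_simps)
    finally show ?thesis using k' by (simp only: b) (simp add: l_def)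
  qed
qed

text \<open>This and the next product are the trace and the determinant of the 2 by 2 block of mode
  \<open>j\<close>, so the two \<open>lambda\<close> values are its eigenvalues.\<close>

lemma lambda_sum: "lambda \<alpha> \<beta> N j 1 + lambda \<alpha> \<beta> N j 2 = - of_real (\<beta> * mu N j)"
  by (simp add: lambda_def field_simps)

lemma lambda_prod: "lambda \<alpha> \<beta> N j 1 * lambda \<alpha> \<beta> N j 2 = of_real (\<alpha>\<^sup>2 * mu N j)"
proof -
  define s where "s = csqrt (of_real (\<beta>\<^sup>2 * (mu N j)\<^sup>2 - 4 * \<alpha>\<^sup>2 * mu N j))"
  have "lambda \<alpha> \<beta> N j 1 * lambda \<alpha> \<beta> N j 2 = (of_real ((\<beta> * mu N j)\<^sup>2) - s\<^sup>2) / 4"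
    unfolding lambda_def s_def[symmetric] by (simp add: field_simps power2_eq_square)
  also have "s\<^sup>2 = of_real (\<beta>\<^sup>2 * (mu N j)\<^sup>2 - 4 * \<alpha>\<^sup>2 * mu N j)"
    unfolding s_def by (rule power2_csqrt)
  finally show ?thesis by (simp add: power_mult_distrib)
qed

text \<open>Equal roots mean a vanishing discriminant
  \<open>mu (\<beta>\<^sup>2 mu - 4 \<alpha>\<^sup>2)\<close>. As \<open>mu\<close> is nonzero for
  \<open>0 < j < N\<close>, the second factor would vanish, which the assumption excludes after
  division by 2.\<close>

lemma lambda_distinct:
  assumes "0 < j" "j < N" "\<beta>\<^sup>2 * (1 - cos (2 * pi * real j / real N)) \<noteq> 2 * \<alpha>\<^sup>2"
  shows "lambda \<alpha> \<beta> N j 1 \<noteq> lambda \<alpha> \<beta> N j 2"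
proof
  assume "lambda \<alpha> \<beta> N j 1 = lambda \<alpha> \<beta> N j 2"
  then have "\<beta>\<^sup>2 * (mu N j)\<^sup>2 - 4 * \<alpha>\<^sup>2 * mu N j = 0"
    unfolding lambda_def by (simp flip: of_real_eq_0_iff[where 'a = complex])
  then have "mu N j * (\<beta>\<^sup>2 * mu N j - 4 * \<alpha>\<^sup>2) = 0"
    by (simp add: power2_eq_square right_diff_distrib mult_ac)
  moreover have "mu N j \<noteq> 0"
    using kappa_cnj_kappa[of N j] kappa_nonzero[OF assms(1,2)] by auto
  ultimately have "\<beta>\<^sup>2 * mu N j = 4 * \<alpha>\<^sup>2" by simp
  with assms(3) show False by (simp add: mu_def algebra_simps)
qed

text \<open>The product of the conjugate transpose of \<open>eigvec N j\<close> with a real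
  sequence. Taking a function instead of a vector lets both halves of the state be reached by an
  index shift.\<close>

definition fourier_coeff :: "nat \<Rightarrow> nat \<Rightarrow> (nat \<Rightarrow> real) \<Rightarrow> complex" where
  "fourier_coeff N j x = (\<Sum>n<N. cnj (eigvec N j $ n) * of_real (x n))"

lemma fourier_expansion:
  "m < N \<Longrightarrow> of_real (x m) = (\<Sum>j<N. eigvec N j $ m * fourier_coeff N j x)"
  using eigvec_expansion[of m N "\<lambda>n. of_real (x n)"] by (simp add: fourier_coeff_def)

lemma fourier_coeff_0: "of_real (sqrt (real N)) * fourier_coeff N 0 x = of_real (\<Sum>n<N. x n)"
proof (cases "N = 0")
  case False
  then show ?thesis
    by (simp add: fourier_coeff_def sum_distrib_left eigvec_0_index)
qed (simp add: fourier_coeff_def)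

text \<open>The vector of index 0 is constant, so its term in the Fourier expansion is the
  arithmetic mean.\<close>

lemma eigvec_0_fourier_coeff_0:
  assumes "m < N"
  shows "eigvec N 0 $ m * fourier_coeff N 0 x = of_real ((\<Sum>n<N. x n) / real N)"
proof -
  have "eigvec N 0 $ m = of_real (sqrt (real N)) / of_nat N"
    using assms real_div_sqrt[of "real N"] by (simp add: eigvec_0_index field_simps flip: of_real_mult)
  then show ?thesis using fourier_coeff_0[of N x] by (simp add: field_simps)
qed

text \<open>The product \<open>\<bullet>c\<close> conjugates its second argument, which makes it
  agree with the conjugate transpose of the eigenvector applied to \<open>x\<close>.\<close>

lemma cvec_cscalar_prod_eigvec:
  assumes "x \<in> carrier_vec N"
  shows "cvec x \<bullet>c eigvec N j = fourier_coeff N j (\<lambda>n. x $ n)"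
  using assms by (simp add: scalar_prod_def fourier_coeff_def atLeast0LessThan conjugate_complex_def mult.commute)

section \<open>The means of the modes\<close>

text \<open>The time \<open>t\<close> is fixed here, so that the modes at that instant and their
  means can be named by plain definitions.\<close>

locale chain_SDE = prob_space M for M :: "'w measure" +
  fixes N :: nat and \<alpha> \<beta> \<sigma> t :: real and W Z :: "real \<Rightarrow> 'w \<Rightarrow> real vec" and Q0 p0 :: "real vec"
  assumes N: "N \<ge> 3"
    and Q0: "Q0 \<in> carrier_vec N" and p0: "p0 \<in> carrier_vec N"
    and W: "standard_brownian_motion_vec M N W"
    and Z: "linear_SDE_solution M (mat_B \<alpha> \<beta> N) (mat_G \<sigma> N) W (Q0 @\<^sub>v p0) Z"
    and discriminant: "\<forall>j\<in>{1..N-1}. \<beta>\<^sup>2 * (1 - cos (2 * pi * real j / real N)) \<noteq> 2 * \<alpha>\<^sup>2"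
    and t: "t \<ge> 0"
begin

definition "Qhat j w = fourier_coeff N j (\<lambda>n. Z t w $ n)"
definition "phat j w = fourier_coeff N j (\<lambda>n. Z t w $ (N + n))"
definition "Q0hat j = fourier_coeff N j (\<lambda>n. Q0 $ n)"
definition "p0hat j = fourier_coeff N j (\<lambda>n. p0 $ n)"
definition "l1 j = lambda \<alpha> \<beta> N j 1"
definition "l2 j = lambda \<alpha> \<beta> N j 2"
definition "e1 j = exp (of_real t * l1 j)"
definition "e2 j = exp (of_real t * l2 j)"
text \<open>Together with \<open>pmean\<close> these are the coefficients of
  \<open>eigvec N j\<close> in the two blocks of the claimed sum.\<close>

definition "Qmean j = (Q0hat j * (e2 j * l1 j - e1 j * l2 j) - p0hat j * (e2 j - e1 j) * kappa N j)
                       / (l1 j - l2 j)"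
definition "pmean j = (Q0hat j * (e2 j - e1 j) * l1 j * l2 j - p0hat j * (e2 j * l2 j - e1 j * l1 j) * kappa N j)
                       / (kappa N j * (l1 j - l2 j))"

lemma has_mean_mode:
  assumes a: "- (of_real (\<alpha>\<^sup>2) * cnj (kappa N j) * b) = c * a"
    and b: "a * kappa N j - of_real (\<beta> * mu N j) * b = c * b"
  shows "has_mean M (\<lambda>w. a * Qhat j w + b * phat j w)
           (exp (of_real t * c) * (a * Q0hat j + b * p0hat j))"
proof -
  define l where "l i = (if i < N then a * cnj (eigvec N j $ i) else b * cnj (eigvec N j $ (i - N)))" for i
  have "has_mean M (\<lambda>w. \<Sum>i<2 * N. l i * of_real (Z t w $ i))
           (exp (of_real t * c) * (\<Sum>i<2 * N. l i * of_real ((Q0 @\<^sub>v p0) $ i)))"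
  proof (rule linear_SDE_mean_left_eigenvector[OF prob_space_axioms mat_B_carrier _ _ W Z _ t])
    show "mat_G \<sigma> N \<in> carrier_mat (2 * N) N"
      by (rule carrier_matI) (simp_all add: mat_G_def append_rows_def)
    show "Q0 @\<^sub>v p0 \<in> carrier_vec (2 * N)"
      using Q0 p0 by (simp add: mult_2)
    show "(\<Sum>i<2 * N. l i * of_real (mat_B \<alpha> \<beta> N $$ (i, k))) = c * l k" if "k < 2 * N" for k
      unfolding l_def using N that a b by (intro mat_B_left_eigenvector) auto
  qed
  moreover have "(\<Sum>i<2 * N. l i * of_real (x i)) =
      a * fourier_coeff N j x + b * fourier_coeff N j (\<lambda>n. x (N + n))" for x
    by (simp add: sum_lessThan_double l_def fourier_coeff_def sum_distrib_left mult.assoc)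
  moreover have "fourier_coeff N j (\<lambda>n. (Q0 @\<^sub>v p0) $ n) = Q0hat j"
    "fourier_coeff N j (\<lambda>n. (Q0 @\<^sub>v p0) $ (N + n)) = p0hat j"
    using Q0 p0 by (auto simp: fourier_coeff_def Q0hat_def p0hat_def intro!: sum.cong)
  ultimately show ?thesis by (simp add: Qhat_def phat_def)
qed

text \<open>For \<open>j = 0\<close> both \<open>kappa\<close> and \<open>mu\<close> vanish, so
  \<open>(1, 0)\<close> and \<open>(0, 1)\<close> are left eigenvectors for the eigenvalue 0 and
  both means stay constant.\<close>

lemma has_mean_mode_0: "has_mean M (Qhat 0) (Q0hat 0)" "has_mean M (phat 0) (p0hat 0)"
  using has_mean_mode[of 0 0 0 1] has_mean_mode[of 0 1 0 0] by (simp_all add: mu_def)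

text \<open>The two left eigenvectors give the means of \<open>y1\<close> and \<open>y2\<close>.
  Since \<open>l1 j \<noteq> l2 j\<close> and \<open>kappa N j \<noteq> 0\<close>, the 2 by 2 system
  can be solved for \<open>Qhat j\<close> and \<open>phat j\<close>.\<close>

lemma has_mean_modes:
  assumes j: "0 < j" "j < N"
  shows "has_mean M (Qhat j) (Qmean j)" "has_mean M (phat j) (pmean j)"
proof -
  have k: "kappa N j \<noteq> 0" using j by (rule kappa_nonzero)
  have d: "l1 j - l2 j \<noteq> 0"
    using lambda_distinct[OF j] discriminant j by (auto simp: l1_def l2_def)
  \<comment> \<open>In the form of \<open>s\<close> and \<open>p\<close>, trace and determinant
    reduce the two eigenvector conditions to polynomial identities in \<open>l1 j\<close> and
    \<open>l2 j\<close>.\<close>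
  have s: "of_real (\<beta> * mu N j) = - (l1 j + l2 j)"
    unfolding l1_def l2_def lambda_sum by simp
  have p: "of_real (\<alpha>\<^sup>2) * cnj (kappa N j) * kappa N j = l1 j * l2 j"
    unfolding l1_def l2_def lambda_prod using kappa_cnj_kappa[of N j] by (simp add: mult_ac)
  define y1 where "y1 w = - l2 j * Qhat j w + kappa N j * phat j w" for w
  define y2 where "y2 w = - l1 j * Qhat j w + kappa N j * phat j w" for w
  have y1: "has_mean M y1 (e1 j * (- l2 j * Q0hat j + kappa N j * p0hat j))"
    unfolding y1_def e1_def by (rule has_mean_mode) (simp only: p s, simp add: algebra_simps)+
  have y2: "has_mean M y2 (e2 j * (- l1 j * Q0hat j + kappa N j * p0hat j))"
    unfolding y2_def e2_def by (rule has_mean_mode) (simp only: p s, simp add: algebra_simps)+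
  \<comment> \<open>The difference \<open>y1 - y2\<close> eliminates \<open>phat j\<close> and
    equals \<open>(l1 j - l2 j) * Qhat j\<close>.\<close>
  have "has_mean M (\<lambda>w. 1 / (l1 j - l2 j) * y1 w + - 1 / (l1 j - l2 j) * y2 w)
      (1 / (l1 j - l2 j) * (e1 j * (- l2 j * Q0hat j + kappa N j * p0hat j))
        + - 1 / (l1 j - l2 j) * (e2 j * (- l1 j * Q0hat j + kappa N j * p0hat j)))"
    by (intro has_mean_add has_mean_mult_right y1 y2)
  also have "(\<lambda>w. 1 / (l1 j - l2 j) * y1 w + - 1 / (l1 j - l2 j) * y2 w) = Qhat j"
    using d by (auto simp: y1_def y2_def fun_eq_iff divide_simps) (simp add: algebra_simps)
  also have "1 / (l1 j - l2 j) * (e1 j * (- l2 j * Q0hat j + kappa N j * p0hat j))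
        + - 1 / (l1 j - l2 j) * (e2 j * (- l1 j * Q0hat j + kappa N j * p0hat j)) = Qmean j"
    using d by (simp add: Qmean_def divide_simps) (simp add: algebra_simps)
  finally show "has_mean M (Qhat j) (Qmean j)" .
  \<comment> \<open>Here \<open>l1 j * y1 - l2 j * y2\<close> eliminates \<open>Qhat j\<close>,
    since its coefficients are opposite multiples of \<open>l1 j * l2 j\<close>.\<close>
  have "has_mean M (\<lambda>w. l1 j / (kappa N j * (l1 j - l2 j)) * y1 w + - l2 j / (kappa N j * (l1 j - l2 j)) * y2 w)
      (l1 j / (kappa N j * (l1 j - l2 j)) * (e1 j * (- l2 j * Q0hat j + kappa N j * p0hat j))
        + - l2 j / (kappa N j * (l1 j - l2 j)) * (e2 j * (- l1 j * Q0hat j + kappa N j * p0hat j)))"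
    by (intro has_mean_add has_mean_mult_right y1 y2)
  also have "(\<lambda>w. l1 j / (kappa N j * (l1 j - l2 j)) * y1 w + - l2 j / (kappa N j * (l1 j - l2 j)) * y2 w) = phat j"
    using d k by (auto simp: y1_def y2_def fun_eq_iff divide_simps) (simp add: algebra_simps)
  also have "l1 j / (kappa N j * (l1 j - l2 j)) * (e1 j * (- l2 j * Q0hat j + kappa N j * p0hat j))
        + - l2 j / (kappa N j * (l1 j - l2 j)) * (e2 j * (- l1 j * Q0hat j + kappa N j * p0hat j)) = pmean j"
    using d k by (simp add: pmean_def divide_simps) (simp add: algebra_simps)
  finally show "has_mean M (phat j) (pmean j)" .
qed

section \<open>Fourier inversion of the means\<close>

lemma sum_modes: "(\<Sum>j<N. f j) = f 0 + (\<Sum>j\<in>{1..N-1}. f j)" for f :: "nat \<Rightarrow> complex"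
proof -
  have "{..<N} = insert 0 {1..N-1}" using N by auto
  then show ?thesis by simp
qed

lemma has_mean_Q:
  assumes m: "m < N"
  shows "has_mean M (\<lambda>w. of_real (Z t w $ m))
           (of_real ((\<Sum>n<N. Q0 $ n) / real N) + (\<Sum>j\<in>{1..N-1}. Qmean j * eigvec N j $ m))"
proof -
  have "has_mean M (\<lambda>w. eigvec N 0 $ m * Qhat 0 w + (\<Sum>j\<in>{1..N-1}. eigvec N j $ m * Qhat j w))
      (eigvec N 0 $ m * Q0hat 0 + (\<Sum>j\<in>{1..N-1}. eigvec N j $ m * Qmean j))"
    by (intro has_mean_add has_mean_sum has_mean_mult_right has_mean_mode_0 has_mean_modes prob_space_axioms) auto
  then show ?thesis
    using fourier_expansion[OF m, of "\<lambda>n. Z t w $ n" for w] m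
    by (simp add: sum_modes Qhat_def Q0hat_def eigvec_0_fourier_coeff_0 mult.commute)
qed

lemma has_mean_p:
  assumes m: "m < N"
  shows "has_mean M (\<lambda>w. of_real (Z t w $ (N + m)))
           (of_real ((\<Sum>n<N. p0 $ n) / real N) + (\<Sum>j\<in>{1..N-1}. pmean j * eigvec N j $ m))"
proof -
  have "has_mean M (\<lambda>w. eigvec N 0 $ m * phat 0 w + (\<Sum>j\<in>{1..N-1}. eigvec N j $ m * phat j w))
      (eigvec N 0 $ m * p0hat 0 + (\<Sum>j\<in>{1..N-1}. eigvec N j $ m * pmean j))"
    by (intro has_mean_add has_mean_sum has_mean_mult_right has_mean_mode_0 has_mean_modes prob_space_axioms) auto
  then show ?thesis
    using fourier_expansion[OF m, of "\<lambda>n. Z t w $ (N + n)" for w] m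
    by (simp add: sum_modes phat_def p0hat_def eigvec_0_fourier_coeff_0 mult.commute)
qed

text \<open>The total momentum is the zero mode scaled by the square root of \<open>N\<close>; the
  projection onto mean-free momenta requires its mean.\<close>

lemma has_mean_total_p: "has_mean M (\<lambda>w. of_real (\<Sum>n<N. Z t w $ (N + n))) (of_real (\<Sum>n<N. p0 $ n))"
  using has_mean_mult_right[OF has_mean_mode_0(2), of "of_real (sqrt (real N))"]
  unfolding phat_def p0hat_def fourier_coeff_0 .

text \<open>Subtracting the average momentum removes exactly the constant contributed by the zero
  mode.\<close>

lemma has_mean_projected_p:
  assumes m: "m < N"
  shows "has_mean M (\<lambda>w. of_real (Z t w $ (N + m) - (\<Sum>n<N. Z t w $ (N + n)) / real N))
           (\<Sum>j\<in>{1..N-1}. pmean j * eigvec N j $ m)"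
  using has_mean_add[OF has_mean_p[OF m] has_mean_mult_right[OF has_mean_total_p, of "- 1 / of_nat N"]]
  by simp

section \<open>The projected process\<close>

lemma Z_carrier: "w \<in> space M \<Longrightarrow> Z t w \<in> carrier_vec (2 * N)"
  using Z t Q0 p0 unfolding linear_SDE_solution_def by (simp add: mult_2)

lemma Z_measurable: "i < 2 * N \<Longrightarrow> (\<lambda>w. Z t w $ i) \<in> borel_measurable M"
  using Z t Q0 p0 unfolding linear_SDE_solution_def by (simp add: mult_2)

text \<open>Every entry of \<open>mat_M N\<close> is the identity entry minus \<open>1 / N\<close>,
  so applying it subtracts the average. The point \<open>w\<close> lies in the space because the
  dimension of \<open>Z t w\<close> is known there.\<close>

lemma proc_X_index:
  assumes w: "w \<in> space M" and m: "m < N"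
  shows "proc_X N Z t w $ m = Z t w $ m"
    "proc_X N Z t w $ (N + m) = Z t w $ (N + m) - (\<Sum>n<N. Z t w $ (N + n)) / real N"
proof -
  have M_index: "mat_M N $$ (m, n) = (if n = m then 1 else 0) - 1 / real N" if "n < N" for n
    using that m by (simp add: mat_M_def scalar_prod_def ones_def mat_of_cols_def mat_of_rows_def)
  have dim: "dim_row (mat_M N) = N" "dim_col (mat_M N) = N"
    by (simp_all add: mat_M_def)
  show "proc_X N Z t w $ m = Z t w $ m"
    using m dim by (simp add: proc_X_def vec_first_def)
  have "proc_X N Z t w $ (N + m) = (\<Sum>n<N. mat_M N $$ (m, n) * Z t w $ (N + n))"
    using m dim Z_carrier[OF w] by (simp add: proc_X_def vec_last_def scalar_prod_def atLeast0LessThan)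
  also have "\<dots> = (\<Sum>n<N. (if n = m then Z t w $ (N + n) else 0) - Z t w $ (N + n) / real N)"
    by (intro sum.cong refl) (simp add: M_index algebra_simps)
  also have "\<dots> = Z t w $ (N + m) - (\<Sum>n<N. Z t w $ (N + n)) / real N"
    using m by (simp add: sum_subtractf sum_divide_distrib)
  finally show "proc_X N Z t w $ (N + m) = Z t w $ (N + m) - (\<Sum>n<N. Z t w $ (N + n)) / real N" .
qed

lemma has_mean_proc_X:
  assumes m: "m < N"
  shows "has_mean M (\<lambda>w. of_real (proc_X N Z t w $ m))
           (of_real ((\<Sum>n<N. Q0 $ n) / real N) + (\<Sum>j\<in>{1..N-1}. Qmean j * eigvec N j $ m))"
    "has_mean M (\<lambda>w. of_real (proc_X N Z t w $ (N + m))) (\<Sum>j\<in>{1..N-1}. pmean j * eigvec N j $ m)"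
  by (rule has_mean_cong_AE[OF has_mean_Q[OF m]], rule AE_I2, simp add: proc_X_index m)
     (rule has_mean_cong_AE[OF has_mean_projected_p[OF m]], rule AE_I2, simp add: proc_X_index m)

lemma proc_X_measurable:
  assumes i: "i < 2 * N" shows "(\<lambda>w. proc_X N Z t w $ i) \<in> borel_measurable M"
proof (cases "i < N")
  case True
  show ?thesis
    using Z_measurable[OF i] by (subst measurable_cong[OF proc_X_index(1)[OF _ True]])
next
  case False
  define m where "m = i - N"
  have m: "m < N" "i = N + m" using False i by (auto simp: m_def)
  have [measurable]: "(\<lambda>w. Z t w $ (N + n)) \<in> borel_measurable M" if "n < N" for n
    using that by (intro Z_measurable) simp
  have "(\<lambda>w. Z t w $ (N + m) - (\<Sum>n<N. Z t w $ (N + n)) / real N) \<in> borel_measurable M"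
    using m by measurable
  then show ?thesis
    unfolding m(2) by (subst measurable_cong[OF proc_X_index(2)[OF _ m(1)]])
qed

text \<open>The oscillating part shared by both expectations, with the coefficients
  abbreviated.\<close>

definition "modes = finsum_vec TYPE(complex) (2 * N)
   (\<lambda>j. (Qmean j \<cdot>\<^sub>v eigvec N j) @\<^sub>v (pmean j \<cdot>\<^sub>v eigvec N j)) {1..N-1}"

text \<open>This assembles the entrywise means into a vector identity once for both processes, which
  differ only in the constant part \<open>c1 @\<^sub>v c2\<close>.\<close>

lemma expectation_modes:
  assumes Y: "\<And>i. i < 2 * N \<Longrightarrow> (\<lambda>w. Y w $ i) \<in> borel_measurable M"
    and c: "c1 \<in> carrier_vec N" "c2 \<in> carrier_vec N"
    and Q: "\<And>m. m < N \<Longrightarrow> has_mean M (\<lambda>w. of_real (Y w $ m))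
              (of_real (c1 $ m) + (\<Sum>j\<in>{1..N-1}. Qmean j * eigvec N j $ m))"
    and p: "\<And>m. m < N \<Longrightarrow> has_mean M (\<lambda>w. of_real (Y w $ (N + m)))
              (of_real (c2 $ m) + (\<Sum>j\<in>{1..N-1}. pmean j * eigvec N j $ m))"
  shows "integrable_vec M (2 * N) Y \<and>
    cvec (expectation_vec M (2 * N) Y) = cvec (c1 @\<^sub>v c2) + modes"
proof
  have carr: "(\<lambda>j. (Qmean j \<cdot>\<^sub>v eigvec N j) @\<^sub>v (pmean j \<cdot>\<^sub>v eigvec N j)) \<in> {1..N-1} \<rightarrow> carrier_vec (2 * N)"
    by (intro Pi_I carrier_vecI) simp
  have "modes \<in> carrier_vec (2 * N)"
    unfolding modes_def by (rule finsum_vec_closed[OF carr])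
  then have dim: "dim_vec modes = 2 * N" by simp
  have *: "has_mean M (\<lambda>w. of_real (Y w $ i)) ((cvec (c1 @\<^sub>v c2) + modes) $ i)" if i: "i < 2 * N" for i
  proof -
    have "modes $ i = (\<Sum>j\<in>{1..N-1}. ((Qmean j \<cdot>\<^sub>v eigvec N j) @\<^sub>v (pmean j \<cdot>\<^sub>v eigvec N j)) $ i)"
      unfolding modes_def by (rule index_finsum_vec[OF _ i carr]) simp
    moreover have "i < N \<or> i - N < N" "i < N + N" using i by auto
    ultimately have eq: "(cvec (c1 @\<^sub>v c2) + modes) $ i =
        (if i < N then of_real (c1 $ i) + (\<Sum>j\<in>{1..N-1}. Qmean j * eigvec N j $ i)
         else of_real (c2 $ (i - N)) + (\<Sum>j\<in>{1..N-1}. pmean j * eigvec N j $ (i - N)))"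
      using c by (auto simp: dim)
    show ?thesis
    proof (cases "i < N")
      case True then show ?thesis unfolding eq using Q by simp
    next
      case False
      then have "i - N < N" "i = N + (i - N)" using i by auto
      then show ?thesis unfolding eq using p[of "i - N"] False by simp
    qed
  qed
  show "integrable_vec M (2 * N) Y"
    unfolding integrable_vec_def using has_mean_of_real(1)[OF * Y] by blast
  show "cvec (expectation_vec M (2 * N) Y) = cvec (c1 @\<^sub>v c2) + modes"
  proof (rule eq_vecI)
    fix i assume "i < dim_vec (cvec (c1 @\<^sub>v c2) + modes)"
    then have i: "i < 2 * N" by (simp add: dim)
    then show "cvec (expectation_vec M (2 * N) Y) $ i = (cvec (c1 @\<^sub>v c2) + modes) $ i"
      using has_mean_of_real(2)[OF * Y, OF i i] by (simp add: expectation_vec_def)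
  qed (simp add: expectation_vec_def dim)
qed

lemma expectation_Z:
  "integrable_vec M (2 * N) (Z t) \<and>
   cvec (expectation_vec M (2 * N) (Z t)) =
     cvec ((((\<Sum>n<N. Q0 $ n) / real N) \<cdot>\<^sub>v ones N) @\<^sub>v (((\<Sum>n<N. p0 $ n) / real N) \<cdot>\<^sub>v ones N)) + modes"
  using Z_measurable has_mean_Q has_mean_p by (intro expectation_modes) (simp_all add: ones_def)

lemma expectation_X:
  "integrable_vec M (2 * N) (proc_X N Z t) \<and>
   cvec (expectation_vec M (2 * N) (proc_X N Z t)) =
     cvec ((((\<Sum>n<N. Q0 $ n) / real N) \<cdot>\<^sub>v ones N) @\<^sub>v 0\<^sub>v N) + modes"
  using proc_X_measurable has_mean_proc_X by (intro expectation_modes) (simp_all add: ones_def)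

end

theorem lemma3p6:
  fixes M :: "'w measure"
    and N :: nat
    and L \<alpha> \<beta> \<sigma> :: real
    and W Z :: "real \<Rightarrow> 'w \<Rightarrow> real vec"
    and Q0 p0 :: "real vec"
  assumes "prob_space M"
    and "N \<ge> 3" and "L > 0" and "\<alpha> > 0" and "\<beta> > 0"
    and "Q0 \<in> carrier_vec N" and "\<forall>n<N. Q0 $ n \<ge> 0" and "(\<Sum>n<N. Q0 $ n) = L"
    and "p0 \<in> carrier_vec N"
    and "standard_brownian_motion_vec M N W"
    and "linear_SDE_solution M (mat_B \<alpha> \<beta> N) (mat_G \<sigma> N) W (Q0 @\<^sub>v p0) Z"
    and "\<forall>j\<in>{1..N-1}. \<beta>\<^sup>2 * (1 - cos (2 * pi * real j / real N)) \<noteq> 2 * \<alpha>\<^sup>2"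
  shows "\<forall>t\<ge>0.
    (let pbar = (1 / real N) * (\<Sum>n<N. p0 $ n);
         S = finsum_vec TYPE(complex) (2 * N)
           (\<lambda>j. let v = eigvec N j; \<kappa> = kappa N j;
                    vQ = cvec Q0 \<bullet>c v; vp = cvec p0 \<bullet>c v;
                    l1 = lambda \<alpha> \<beta> N j 1; l2 = lambda \<alpha> \<beta> N j 2;
                    e1 = exp (of_real t * l1); e2 = exp (of_real t * l2)
                in (((vQ * (e2 * l1 - e1 * l2) - vp * (e2 - e1) * \<kappa>)
                       / (l1 - l2)) \<cdot>\<^sub>v v)
                   @\<^sub>v
                   (((vQ * (e2 - e1) * l1 * l2 - vp * (e2 * l2 - e1 * l1) * \<kappa>)
                       / (\<kappa> * (l1 - l2))) \<cdot>\<^sub>v v))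
           {1..N-1}
     in integrable_vec M (2 * N) (Z t) \<and>
        cvec (expectation_vec M (2 * N) (Z t))
          = cvec (((L / real N) \<cdot>\<^sub>v ones N) @\<^sub>v (pbar \<cdot>\<^sub>v ones N)) + S \<and>
        integrable_vec M (2 * N) (proc_X N Z t) \<and>
        cvec (expectation_vec M (2 * N) (proc_X N Z t))
          = cvec (((L / real N) \<cdot>\<^sub>v ones N) @\<^sub>v 0\<^sub>v N) + S)"
proof (intro allI impI, goal_cases)
  case (1 t)
  with assms interpret chain_SDE M N \<alpha> \<beta> \<sigma> t W Z Q0 p0
    by (simp add: chain_SDE_def chain_SDE_axioms_def)
  have pbar: "1 / real N * (\<Sum>n<N. p0 $ n) = (\<Sum>n<N. p0 $ n) / real N" by simp
  \<comment> \<open>Unfolding restores the explicit coefficients of the claim, and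
    \<open>assms(8)\<close> replaces the sum of the initial distances by \<open>L\<close>.\<close>
  show ?case
    using expectation_Z expectation_X
    unfolding Let_def pbar modes_def Qmean_def pmean_def e1_def e2_def l1_def l2_def Q0hat_def p0hat_def
      cvec_cscalar_prod_eigvec[OF Q0] cvec_cscalar_prod_eigvec[OF p0] assms(8)
    by blast
qed

end
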